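(* For every $(p,q)\in(\mathbb{N}^* )^2$ and every $m\in\mathbb{N}$, the sequence $\left(u_{p,q,m}^{(n)}\right)_{n\in\mathbb{N}}$ defined by $u_{p,q,m}^{(n)}=S_{p,q}^{(n)}+(-1)^{n+1}\rho_{p,q,m}^{(n)}$ converges infra-linearly to $S_{p,q}$, but faster than the sequence $\left(S_{p,q}^{(n)}\right)_{n\in\mathbb{N}}$, with $$\left|u_{p,q,m}^{(n)}-S_{p,q}\right|=\left|\rho_{p,q,m}^{(n)}-R_{p,q}^{(n)}\right|\underset{n\to+\infty}{\sim}\frac{(m+1)!^2}{2^{2m+3}\,p}\,\frac{1}{n^{2m+3}}.$$
   Context: $\mathbb{N}^*$ denotes the positive integers and $\mathbb{N}$ the nonnegative integers. For $(p,q)\in(\mathbb{N}^* )^2$ and $n\in\mathbb{N}$, put $S_{p,q}=\sum_{k=0}^{+\infty}\frac{(-1)^k}{pk+q}$, $S_{p,q}^{(n)}=\sum_{k=0}^{n}\frac{(-1)^k}{pk+q}$, and $\alpha_{p,q}^{(n)}=2pn+p+2q$. For $m\in\mathbb{N}$, $\rho_{p,q,m}^{(n)}$ is the finite generalized continued fraction $$\rho_{p,q,m}^{(n)}=\cfrac{1}{\alpha+\cfrac{(1p)^2}{\alpha+\cfrac{(2p)^2}{\alpha+\cdots+\cfrac{(mp)^2}{\alpha}}}},\qquad \alpha=\alpha_{p,q}^{(n)},$$ with $\rho_{p,q,0}^{(n)}=1/\alpha_{p,q}^{(n)}$. The quantity $R_{p,q}^{(n)}$ is determined by $S_{p,q}=S_{p,q}^{(n)}+(-1)^{n+1}R_{p,q}^{(n)}$;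 by a previously known theorem it equals $\lim_{m\to+\infty}\rho_{p,q,m}^{(n)}$, the value of the corresponding infinite continued fraction. A real sequence $(u_n)$ converging to $\ell$ converges infra-linearly if $\left|\frac{u_{n+1}-\ell}{u_n-\ell}\right|$ is defined and converges to $1$. If $(v_n)$ also converges to $\ell$, then $(v_n)$ converges faster than $(u_n)$ if $\left|\frac{v_n-\ell}{u_n-\ell}\right|\to 0$. The notation $a_n\sim b_n$ means $a_n/b_n\to1$, and $(m+1)!^2=((m+1)!)^2$. *)

theory Defs
  imports Complex_Main "HOL-Library.Landau_Symbols"
begin

definition S :: "nat \<Rightarrow> nat \<Rightarrow> real" where
  "S p q = (\<Sum>k. (-1) ^ k / real (p * k + q))"

definition S_part :: "nat \<Rightarrow> nat \<Rightarrow> nat \<Rightarrow> real" where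
  "S_part p q n = (\<Sum>k\<le>n. (-1) ^ k / real (p * k + q))"

definition R :: "nat \<Rightarrow> nat \<Rightarrow> nat \<Rightarrow> real" where
  "R p q n = (-1) ^ (n + 1) * (S p q - S_part p q n)"

lemma S_eq_R: "S p q = S_part p q n + (-1) ^ (n + 1) * R p q n"
proof -
  have "(-1 :: real) ^ (n + 1) * (-1) ^ (n + 1) = 1"
    by (simp flip: power_mult_distrib)
  then show ?thesis
    unfolding R_def by (simp only: mult.assoc [symmetric]) simp
qed

lemma R_unique: "S p q = S_part p q n + (-1) ^ (n + 1) * r \<longleftrightarrow> r = R p q n"
  using S_eq_R [of p q n] by auto

lemma S_summable:
  assumes "p > 0" "q > 0"
  shows "summable (\<lambda>k. (-1) ^ k / real (p * k + q))"
proof -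
  have "(\<lambda>k. 1 / real (p * k + q)) \<longlonglongrightarrow> 0"
  proof (rule tendsto_sandwich [OF _ _ tendsto_const LIMSEQ_inverse_real_of_nat])
    show "\<forall>\<^sub>F k in sequentially. 1 / real (p * k + q) \<le> inverse (real (Suc k))"
    proof (rule always_eventually, rule allI)
      fix k
      have "Suc k \<le> p * k + q"
        using assms mult_le_mono1 [of 1 p k] by linarith
      then have "real (Suc k) \<le> real (p * k + q)"
        by (simp only: of_nat_le_iff)
      then show "1 / real (p * k + q) \<le> inverse (real (Suc k))"
        unfolding inverse_eq_divide by (intro divide_left_mono mult_pos_pos) linarith+
    qed
  qed simp
  moreover have "decseq (\<lambda>k. 1 / real (p * k + q))"
    unfolding decseq_Suc_iff using assms
    by (auto intro!: divide_left_mono mult_pos_pos add_nonneg_pos simp del: of_nat_add of_nat_mult)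
  ultimately show ?thesis
    using summable_Leibniz(1) [of "\<lambda>k. 1 / real (p * k + q)"]
    by (simp add: monoseq_iff)
qed

definition alpha :: "nat \<Rightarrow> nat \<Rightarrow> nat \<Rightarrow> real" where
  "alpha p q n = real (2 * p * n + p + 2 * q)"

text \<open>
  \<open>cf_denom p a r j\<close> is the finite continued fraction
  \<open>a + (jp)^2 / (a + ((j+1)p)^2 / (a + \<dots> + ((j+r-1)p)^2 / a))\<close>,
  with \<open>r\<close> partial quotients below the leading \<open>a\<close>.
\<close>

primrec cf_denom :: "nat \<Rightarrow> real \<Rightarrow> nat \<Rightarrow> nat \<Rightarrow> real" where
  "cf_denom p a 0 j = a"
| "cf_denom p a (Suc r) j = a + (real (j * p))\<^sup>2 / cf_denom p a r (Suc j)"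

definition rho :: "nat \<Rightarrow> nat \<Rightarrow> nat \<Rightarrow> nat \<Rightarrow> real" where
  "rho p q m n = 1 / cf_denom p (alpha p q n) m 1"

definition u :: "nat \<Rightarrow> nat \<Rightarrow> nat \<Rightarrow> nat \<Rightarrow> real" where
  "u p q m n = S_part p q n + (-1) ^ (n + 1) * rho p q m n"

text \<open>
  Division by zero yields \<open>0\<close> in HOL, so that the quotients below are defined
  is stated explicitly by requiring nonzero denominators.
\<close>

definition infra_linear :: "(nat \<Rightarrow> real) \<Rightarrow> real \<Rightarrow> bool" where
  "infra_linear x l \<longleftrightarrow> x \<longlonglongrightarrow> l \<and> (\<forall>n. x n \<noteq> l) \<and>
     (\<lambda>n. \<bar>(x (n + 1) - l) / (x n - l)\<bar>) \<longlonglongrightarrow> 1"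

definition converges_faster :: "(nat \<Rightarrow> real) \<Rightarrow> (nat \<Rightarrow> real) \<Rightarrow> real \<Rightarrow> bool" where
  "converges_faster y x l \<longleftrightarrow> x \<longlonglongrightarrow> l \<and> y \<longlonglongrightarrow> l \<and> (\<forall>n. x n \<noteq> l) \<and>
     (\<lambda>n. \<bar>(y n - l) / (x n - l)\<bar>) \<longlonglongrightarrow> 0"

end

(*
  The error e(n) = rho_m(n) - R(n) satisfies e(n) + e(n+1) = d(n), since R(n) + R(n+1) is the first
  omitted term 2/(alpha + p) of the series.  Propagating a bilinear relation through the levels of
  the continued fraction shows that d(n) is (-1)^m times an explicit positive decreasing function,
  so e(n) has sign (-1)^m (it never vanishes) and |e(n)| < |d(n)|.  The sharp asymptotics come from
  writing e as (rho_m - rho_{m+1}) + (rho_{m+1} - R): the first difference has an explicit leading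
  term and the second is of smaller order by the bound just obtained.
*)
theory Submission
  imports Defs "HOL-Real_Asymp.Real_Asymp"
begin

section \<open>Finite continued fractions and their continuants\<close>

lemma cf_denom_ge:
  assumes "a > 0"
  shows "cf_denom p a r j \<ge> a"
proof (induction r arbitrary: j)
  case (Suc r)
  have "cf_denom p a r (Suc j) > 0"
    using Suc [of "Suc j"] assms by linarith
  then show ?case by simp
qed simp

lemma cf_denom_pos: "a > 0 \<Longrightarrow> cf_denom p a r j > 0"
  using cf_denom_ge [of a p r j] by linarith

text \<open>The product of all proper tails. Once the inner fractions are cleared,
  \<open>cf_denom p a r j\<close> has denominator \<open>cf_tail_prod p a r j\<close> and numerator
  the product of the two.\<close>

primrec cf_tail_prod :: "nat \<Rightarrow> real \<Rightarrow> nat \<Rightarrow> nat \<Rightarrow> real" where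
  "cf_tail_prod p a 0 j = 1"
| "cf_tail_prod p a (Suc r) j = cf_denom p a r (Suc j) * cf_tail_prod p a r (Suc j)"

lemma cf_tail_prod_ge:
  assumes "a > 0"
  shows "cf_tail_prod p a r j \<ge> a ^ r"
proof (induction r arbitrary: j)
  case (Suc r)
  show ?case
    using mult_mono [OF cf_denom_ge [OF assms] Suc] assms cf_denom_pos [OF assms]
    by (simp add: less_imp_le)
qed simp

lemma cf_tail_prod_pos: "a > 0 \<Longrightarrow> cf_tail_prod p a r j > 0"
  using cf_tail_prod_ge [of a r p j] zero_less_power [of a r] by linarith

text \<open>
  Although the tails themselves are not monotone in \<open>a\<close>, these products are, being the
  continuants, i.e. polynomials in \<open>a\<close> with nonnegative coefficients.
\<close>
lemma cf_tail_prod_mono: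
  assumes "0 < a" "a \<le> b"
  shows "cf_tail_prod p a r j \<le> cf_tail_prod p b r j"
    and "cf_denom p a r j * cf_tail_prod p a r j \<le> cf_denom p b r j * cf_tail_prod p b r j"
proof (induction r arbitrary: j)
  case 0
  { case 1 show ?case by simp }
  { case 2 show ?case using assms by simp }
next
  case (Suc r)
  { case 1 show ?case using Suc(2) by simp }
  { case 2
    \<comment> \<open>Multiplying by the next tail clears the division and gives the three-term
      recurrence of continuants. It involves both claims at the lower level, hence the joint
      induction.\<close>
    have step: "cf_denom p c (Suc r) j * cf_tail_prod p c (Suc r) j
        = c * (cf_denom p c r (Suc j) * cf_tail_prod p c r (Suc j))
          + (real (j * p))\<^sup>2 * cf_tail_prod p c r (Suc j)" if "c > 0" for c
      using cf_denom_pos [OF that, of p r "Suc j"] by (simp add: field_simps)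
    show ?case
      unfolding step [OF assms(1)] step [OF less_le_trans [OF assms]]
      using assms cf_denom_pos [OF assms(1)] cf_tail_prod_pos [OF assms(1)]
      by (intro add_mono mult_mono Suc) (auto simp: less_imp_le)
  }
qed

section \<open>A bilinear relation between the tails at \<open>a\<close> and
  \<open>a + 2p\<close>\<close>

text \<open>
  The zero set of the following polynomial describes how the \<open>j\<close>-th tails \<open>x\<close>, \<open>y\<close> of the infinite
  continued fractions with parameters \<open>a\<close> and \<open>a + 2p\<close> are related; for \<open>j = 1\<close> it says
  \<open>1/x + 1/y = 2/(a + p)\<close>.
\<close>
definition tail_rel :: "real \<Rightarrow> real \<Rightarrow> real \<Rightarrow> real \<Rightarrow> real \<Rightarrow> real" where
  "tail_rel p a j x y = 2 * (x - a) * (y - a - 2 * p) + (x - a) * (a + (2 * j + 1) * p)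
     + (y - a - 2 * p) * (a - (2 * j - 1) * p) - 2 * (j * p)\<^sup>2"

text \<open>The form of \<open>tail_rel\<close> is preserved when both fractions are extended by one
  level: substituting and clearing denominators returns the same polynomial with j + 1 in place of
  j, up to a negative factor.\<close>

lemma tail_rel_step:
  assumes "x \<noteq> 0" "y \<noteq> 0"
  shows "tail_rel p a j (a + (j * p)\<^sup>2 / x) (a + 2 * p + (j * p)\<^sup>2 / y)
    = - ((j * p)\<^sup>2 * tail_rel p a (j + 1) x y / (x * y))"
  using assms unfolding tail_rel_def by (simp add: field_simps power2_eq_square)

text \<open>At the innermost level x = a and y = a + 2p, so only the constant term of
  \<open>tail_rel\<close> survives. Each level above contributes the factor of
  \<open>tail_rel_step\<close>: the squares collect into the Pochhammer symbol, the denominators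
  into the tail products.\<close>

lemma tail_rel_cf_denom:
  assumes "a > 0"
  shows "tail_rel (real p) a (real j) (cf_denom p a r j) (cf_denom p (a + 2 * real p) r j)
    = (-1) ^ Suc r * 2 * (pochhammer (real j) (Suc r) * real p ^ Suc r)\<^sup>2
      / (cf_tail_prod p a r j * cf_tail_prod p (a + 2 * real p) r j)"
proof (induction r arbitrary: j)
  case 0
  show ?case by (simp add: tail_rel_def)
next
  case (Suc r)
  let ?x = "cf_denom p a r (Suc j)" and ?y = "cf_denom p (a + 2 * real p) r (Suc j)"
  have pos: "?x > 0" "?y > 0"
    using assms by (auto intro!: cf_denom_pos add_pos_nonneg)
  have "tail_rel (real p) a (real j) (cf_denom p a (Suc r) j) (cf_denom p (a + 2 * real p) (Suc r) j)
    = - ((real j * p)\<^sup>2 * tail_rel (real p) a (real (Suc j)) ?x ?y / (?x * ?y))"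
    using tail_rel_step [of ?x ?y "real p" a "real j"] pos by (simp add: add_ac)
  also have "\<dots> = (-1) ^ Suc (Suc r) * 2
      * (pochhammer (real j) (Suc (Suc r)) * real p ^ Suc (Suc r))\<^sup>2
      / (cf_tail_prod p a (Suc r) j * cf_tail_prod p (a + 2 * real p) (Suc r) j)"
    unfolding Suc.IH [of "Suc j"] pochhammer_rec [of "real j" "Suc r"]
    by (simp add: power_mult_distrib mult_ac add_ac)
  finally show ?case .
qed

text \<open>Written through continuants rather than tails, since these are monotone in
  \<open>a\<close>.\<close>

definition cf_gap :: "nat \<Rightarrow> nat \<Rightarrow> real \<Rightarrow> real" where
  "cf_gap p m a = 2 * (fact (m + 1) * real p ^ (m + 1))\<^sup>2
     / ((a + p) * (cf_denom p a m 1 * cf_tail_prod p a m 1)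
        * (cf_denom p (a + 2 * real p) m 1 * cf_tail_prod p (a + 2 * real p) m 1))"

lemma cf_denom_sum_inverse:
  assumes "a > 0"
  shows "1 / cf_denom p a m 1 + 1 / cf_denom p (a + 2 * real p) m 1 - 2 / (a + p)
    = (-1) ^ m * cf_gap p m a"
proof -
  let ?x = "cf_denom p a m 1" and ?y = "cf_denom p (a + 2 * real p) m 1"
  have pos: "?x > 0" "?y > 0" "a + p > 0"
    using assms by (auto intro!: cf_denom_pos add_pos_nonneg)
  \<comment> \<open>For j = 1 the constant terms cancel and \<open>tail_rel\<close> equals 2xy - (a
    + p)(x + y).\<close>
  have "1 / ?x + 1 / ?y - 2 / (a + p) = - tail_rel (real p) a 1 ?x ?y / ((a + p) * ?x * ?y)"
    using pos unfolding tail_rel_def by (simp add: divide_simps) algebra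
  also have "\<dots> = (-1) ^ m * cf_gap p m a"
    using tail_rel_cf_denom [OF assms, of p 1 m]
    by (simp add: cf_gap_def pochhammer_fact [symmetric] mult_ac)
  finally show ?thesis .
qed

text \<open>The factor a + p of the denominator supplies strictness, and the continuants are weakly
  increasing by \<open>cf_tail_prod_mono\<close>.\<close>

lemma cf_gap_strict_decreasing:
  assumes "0 < a" "a < b" "p > 0"
  shows "cf_gap p m b < cf_gap p m a"
proof -
  have b: "b > 0" using assms by linarith
  have ap: "a + 2 * real p > 0" using assms by (auto intro: add_pos_nonneg)
  have bp: "b + 2 * real p > 0" using b by (auto intro: add_pos_nonneg)
  note pos = cf_denom_pos cf_tail_prod_pos
  have strict: "(a + p) * (cf_denom p a m 1 * cf_tail_prod p a m 1)
        < (b + p) * (cf_denom p b m 1 * cf_tail_prod p b m 1)"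
    using assms
    by (intro mult_less_le_imp_less [OF _ cf_tail_prod_mono(2)]) (auto intro!: mult_pos_pos pos)
  have le: "cf_denom p (a + 2 * real p) m 1 * cf_tail_prod p (a + 2 * real p) m 1
        \<le> cf_denom p (b + 2 * real p) m 1 * cf_tail_prod p (b + 2 * real p) m 1"
    using assms ap by (intro cf_tail_prod_mono) auto
  show ?thesis
    unfolding cf_gap_def
  proof (rule divide_strict_left_mono [OF mult_less_le_imp_less [OF strict le]])
    show "0 \<le> (a + p) * (cf_denom p a m 1 * cf_tail_prod p a m 1)"
      using assms by (intro mult_nonneg_nonneg less_imp_le [OF pos(1)] less_imp_le [OF pos(2)]) auto
  qed (use assms b ap bp in \<open>auto intro!: mult_pos_pos pos add_pos_pos\<close>)
qed

lemma power_double_add_3: "x ^ (2 * m + 3) = x * (x * x ^ m) * (x * x ^ m)"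
  for x :: "'a :: monoid_mult"
proof -
  have "2 * m + 3 = 1 + (1 + m) + (1 + m)" by simp
  then show ?thesis by (simp only: power_add power_one_right)
qed

text \<open>Each of the two continuants is a product of m + 1 tails, all at least \<open>a\<close>;
  with a + p this makes 2m + 3 factors.\<close>

lemma cf_gap_le:
  assumes "a > 0"
  shows "cf_gap p m a \<le> 2 * (fact (m + 1) * real p ^ (m + 1))\<^sup>2 / a ^ (2 * m + 3)"
proof -
  have ge: "c * c ^ m \<le> cf_denom p c m 1 * cf_tail_prod p c m 1" if "c > 0" for c
    using that cf_denom_pos [OF that] by (intro mult_mono cf_denom_ge cf_tail_prod_ge) (auto simp: less_imp_le)
  have h1: "a * a ^ m \<le> cf_denom p a m 1 * cf_tail_prod p a m 1"
    using assms by (rule ge)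
  have "a * a ^ m \<le> (a + 2 * real p) * (a + 2 * real p) ^ m"
    using assms by (intro mult_mono power_mono) auto
  also have "\<dots> \<le> cf_denom p (a + 2 * real p) m 1 * cf_tail_prod p (a + 2 * real p) m 1"
    using assms by (intro ge) (auto intro: add_pos_nonneg)
  finally have h2: "a * a ^ m \<le> \<dots>" .
  have "a ^ (2 * m + 3) = a * (a * a ^ m) * (a * a ^ m)"
    by (rule power_double_add_3)
  also have "\<dots> \<le> (a + p) * (cf_denom p a m 1 * cf_tail_prod p a m 1)
        * (cf_denom p (a + 2 * real p) m 1 * cf_tail_prod p (a + 2 * real p) m 1)"
    by (rule mult_mono [OF mult_mono [OF _ h1] h2])
       (use assms cf_denom_pos [OF assms] cf_tail_prod_pos [OF assms] in \<open>auto simp: less_imp_le\<close>)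
  finally show ?thesis
    unfolding cf_gap_def using assms by (intro divide_left_mono) (auto intro!: mult_pos_pos cf_denom_pos cf_tail_prod_pos add_pos_nonneg)
qed

section \<open>Differences of consecutive convergents for large \<open>a\<close>\<close>

lemma cf_denom_asymp: "((\<lambda>a. cf_denom p a r j / a) \<longlongrightarrow> 1) at_top"
proof (cases r)
  case 0
  have "((\<lambda>a::real. a / a) \<longlongrightarrow> 1) at_top" by real_asymp
  then show ?thesis using 0 by simp
next
  case (Suc k)
  let ?c = "(real (j * p))\<^sup>2"
  have lim: "((\<lambda>a. 1 + ?c / a\<^sup>2) \<longlongrightarrow> 1) at_top" by real_asymp
  show ?thesis
  proof (rule tendsto_sandwich [OF _ _ tendsto_const lim])
    show "\<forall>\<^sub>F a in at_top. 1 \<le> cf_denom p a r j / a"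
      using eventually_gt_at_top [of 0]
      by eventually_elim (simp add: cf_denom_ge)
    show "\<forall>\<^sub>F a in at_top. cf_denom p a r j / a \<le> 1 + ?c / a\<^sup>2"
      using eventually_gt_at_top [of 0]
    proof eventually_elim
      case (elim a)
      have "?c / cf_denom p a k (Suc j) \<le> ?c / a"
        using elim cf_denom_ge [OF elim] cf_denom_pos [OF elim]
        by (intro divide_left_mono) auto
      then have "(a + ?c / cf_denom p a k (Suc j)) / a \<le> (a + ?c / a) / a"
        using elim by (intro divide_right_mono) auto
      also have "\<dots> = 1 + ?c / a\<^sup>2"
        using elim by (simp add: add_divide_distrib power2_eq_square)
      finally show ?case using Suc by simp
    qed
  qed
qed

text \<open>Going up one level multiplies the difference of two tails x, y by -(jp)^2/(xy), where x
  and y are asymptotic to \<open>a\<close>. So each level costs two powers of \<open>a\<close> and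
  one sign.\<close>

lemma cf_denom_diff_asymp:
  "((\<lambda>a. a ^ (2 * r + 1) * (cf_denom p a (Suc r) j - cf_denom p a r j))
     \<longlongrightarrow> (-1) ^ r * (pochhammer (real j) (Suc r) * real p ^ Suc r)\<^sup>2) at_top"
proof (induction r arbitrary: j)
  case 0
  show ?case
    by (rule tendsto_eventually)
       (use eventually_gt_at_top [of 0] in eventually_elim, simp)
next
  case (Suc r)
  let ?x = "\<lambda>a. cf_denom p a (Suc r) (Suc j)" and ?y = "\<lambda>a. cf_denom p a r (Suc j)"
  let ?f = "\<lambda>a. - (real (j * p))\<^sup>2 * (a ^ (2 * r + 1) * (?x a - ?y a)) / ((?x a / a) * (?y a / a))"
  have "(?f \<longlongrightarrow> - (real (j * p))\<^sup>2 * ((-1) ^ r * (pochhammer (real (Suc j)) (Suc r) * real p ^ Suc r)\<^sup>2) / (1 * 1)) at_top"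
    by (intro tendsto_intros Suc cf_denom_asymp) auto
  moreover have "\<forall>\<^sub>F a in at_top. ?f a
      = a ^ (2 * Suc r + 1) * (cf_denom p a (Suc (Suc r)) j - cf_denom p a (Suc r) j)"
    using eventually_gt_at_top [of 0]
  proof eventually_elim
    case (elim a)
    define x y where "x = ?x a" and "y = ?y a"
    have pos: "x > 0" "y > 0"
      unfolding x_def y_def by (rule cf_denom_pos [OF elim])+
    have "cf_denom p a (Suc (Suc r)) j - cf_denom p a (Suc r) j
      = (real (j * p))\<^sup>2 / x - (real (j * p))\<^sup>2 / y"
      unfolding x_def y_def cf_denom.simps(2) [of p a _ j] by simp
    also have "\<dots> = - (real (j * p))\<^sup>2 * (x - y) / (x * y)"
      using pos by (simp add: field_simps)
    finally have eq: "cf_denom p a (Suc (Suc r)) j - cf_denom p a (Suc r) j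
      = - (real (j * p))\<^sup>2 * (x - y) / (x * y)" .
    show ?case
      unfolding eq x_def [symmetric] y_def [symmetric] using pos elim
      by (simp add: field_simps)
  qed
  ultimately show ?case
    unfolding pochhammer_rec [of "real j" "Suc r"]
    by (auto elim!: Lim_transform_eventually simp: power_mult_distrib mult_ac add_ac)
qed

text \<open>Taking reciprocals divides the difference by xy, asymptotically a^2, which raises the
  exponent from 2m + 1 to 2m + 3.\<close>

lemma cf_convergent_diff_asymp:
  "((\<lambda>a. a ^ (2 * m + 3) * (1 / cf_denom p a m 1 - 1 / cf_denom p a (Suc m) 1))
     \<longlongrightarrow> (-1) ^ m * (fact (m + 1) * real p ^ (m + 1))\<^sup>2) at_top"
proof -
  let ?x = "\<lambda>a. cf_denom p a (Suc m) 1" and ?y = "\<lambda>a. cf_denom p a m 1"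
  let ?f = "\<lambda>a. a ^ (2 * m + 1) * (?x a - ?y a) / ((?x a / a) * (?y a / a))"
  have "(?f \<longlongrightarrow> (-1) ^ m * (pochhammer (real 1) (Suc m) * real p ^ Suc m)\<^sup>2 / (1 * 1)) at_top"
    by (intro tendsto_intros cf_denom_diff_asymp cf_denom_asymp) auto
  moreover have "\<forall>\<^sub>F a in at_top. ?f a = a ^ (2 * m + 3) * (1 / ?y a - 1 / ?x a)"
    using eventually_gt_at_top [of 0]
  proof eventually_elim
    case (elim a)
    define x y where "x = ?x a" and "y = ?y a"
    have "x > 0" "y > 0"
      unfolding x_def y_def by (rule cf_denom_pos [OF elim])+
    then show ?case
      unfolding x_def [symmetric] y_def [symmetric] using elim
      by (simp add: field_simps power3_eq_cube power_add)
  qed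
  ultimately show ?thesis
    by (auto elim!: Lim_transform_eventually simp: pochhammer_fact [symmetric])
qed

section \<open>Remainders of the series and the sign of the errors\<close>

lemma alternating_pos:
  fixes e d :: "nat \<Rightarrow> real"
  assumes lim: "e \<longlonglongrightarrow> 0" and rec: "\<And>n. e n + e (Suc n) = d n" and dec: "\<And>n. d (Suc n) < d n"
  shows "e n > 0" and "e n < d n"
proof -
  have pos: "e n > 0" for n
  proof -
    \<comment> \<open>Subtracting consecutive relations gives e(k) - e(k+2) = d(k) - d(k+1) >
      0.\<close>
    have step: "e (Suc (Suc k)) < e k" for k
      using rec [of k] rec [of "Suc k"] dec [of k] by linarith
    have "decseq (\<lambda>k. e (n + 2 * k))"
      unfolding decseq_Suc_iff using step by (auto simp: less_imp_le)
    moreover have "(\<lambda>k. e (n + 2 * k)) \<longlonglongrightarrow> 0"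
      using lim by (rule filterlim_compose) real_asymp
    \<comment> \<open>The limit only yields nonnegativity, so it is applied two indices later and
      one strict step leads back to n.\<close>
    ultimately have "0 \<le> e (n + 2 * 1)"
      using decseq_ge by blast
    then show ?thesis using step [of n] by simp
  qed
  from pos [of n] show "e n > 0" .
  from pos [of "Suc n"] show "e n < d n" using rec [of n] by linarith
qed

context
  fixes p q :: nat
  assumes p: "p > 0" and q: "q > 0"
begin

lemma S_part_tendsto: "S_part p q \<longlonglongrightarrow> S p q"
  using summable_LIMSEQ' [OF S_summable [OF p q]]
  unfolding S_def S_part_def [abs_def] .

lemma R_tendsto_0: "R p q \<longlonglongrightarrow> 0"
proof -
  have "(\<lambda>n. S p q - S_part p q n) \<longlonglongrightarrow> 0"
    using tendsto_diff [OF tendsto_const S_part_tendsto, of "S p q"] by simp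
  then have "(\<lambda>n. \<bar>R p q n\<bar>) \<longlonglongrightarrow> 0"
    by (simp add: R_def abs_mult tendsto_rabs_zero_iff)
  then show ?thesis by (simp add: tendsto_rabs_zero_iff)
qed

lemma alpha_pos: "alpha p q n > 0"
  unfolding alpha_def of_nat_0_less_iff using p by simp

lemma alpha_Suc: "alpha p q (Suc n) = alpha p q n + 2 * real p"
  by (simp add: alpha_def algebra_simps)

lemma alpha_at_top: "filterlim (alpha p q) at_top sequentially"
  using p unfolding alpha_def by real_asymp

lemma R_add_R_Suc: "R p q n + R p q (Suc n) = 2 / (alpha p q n + p)"
proof -
  have "R p q n + R p q (Suc n)
    = (-1) ^ Suc n * ((-1) ^ Suc n / real (p * Suc n + q))"
    unfolding R_def S_part_def by (simp add: algebra_simps)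
  also have "\<dots> = 1 / real (p * Suc n + q)"
    by (simp flip: power_mult_distrib)
  also have "\<dots> = 2 / (2 * real (p * Suc n + q))"
    by (metis mult_divide_mult_cancel_left mult.right_neutral zero_neq_numeral)
  also have "2 * real (p * Suc n + q) = alpha p q n + p"
    by (simp add: alpha_def algebra_simps)
  finally show ?thesis .
qed

text \<open>\<open>alternating_pos\<close> applies with d(n) = 2/(alpha + p), which decreases
  strictly because alpha grows by 2p.\<close>

lemma R_pos: "R p q n > 0"
  using alpha_pos p
  by (intro alternating_pos(1) [OF R_tendsto_0 R_add_R_Suc])
     (auto intro!: divide_strict_left_mono mult_pos_pos add_pos_pos simp: alpha_Suc)

lemma rho_tendsto_0: "rho p q m \<longlonglongrightarrow> 0"
proof (rule tendsto_sandwich [OF _ _ tendsto_const])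
  show "(\<lambda>n. 1 / alpha p q n) \<longlonglongrightarrow> 0"
    using p unfolding alpha_def by real_asymp
  show "\<forall>\<^sub>F n in sequentially. 0 \<le> rho p q m n"
    unfolding rho_def using alpha_pos by (auto simp: less_imp_le cf_denom_pos)
  show "\<forall>\<^sub>F n in sequentially. rho p q m n \<le> 1 / alpha p q n"
    unfolding rho_def using alpha_pos
    by (intro always_eventually allI divide_left_mono mult_pos_pos cf_denom_ge cf_denom_pos) auto
qed

text \<open>Passing from n to n + 1 shifts alpha by 2p, which is the pairing of
  \<open>cf_denom_sum_inverse\<close>; its term 2/(a + p) cancels against R(n) + R(n+1). Then
  \<open>alternating_pos\<close> applies to the error multiplied by (-1)^m.\<close>

lemma rho_error_bounds:
  shows "(-1) ^ m * (rho p q m n - R p q n) > 0"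
    and "(-1) ^ m * (rho p q m n - R p q n) < cf_gap p m (alpha p q n)"
proof -
  let ?e = "\<lambda>n. (-1) ^ m * (rho p q m n - R p q n)"
  have lim: "?e \<longlonglongrightarrow> 0"
    using tendsto_mult [OF tendsto_const tendsto_diff [OF rho_tendsto_0 R_tendsto_0]] by simp
  have rec: "?e n + ?e (Suc n) = cf_gap p m (alpha p q n)" for n
  proof -
    have "?e n + ?e (Suc n) = (-1) ^ m * (rho p q m n + rho p q m (Suc n)
      - (R p q n + R p q (Suc n)))" by (simp add: algebra_simps)
    also have "\<dots> = (-1) ^ m * ((-1) ^ m * cf_gap p m (alpha p q n))"
      unfolding R_add_R_Suc rho_def alpha_Suc
      by (simp only: cf_denom_sum_inverse [OF alpha_pos])
    finally show ?thesis by (simp flip: power_mult_distrib mult.assoc)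
  qed
  have dec: "cf_gap p m (alpha p q (Suc n)) < cf_gap p m (alpha p q n)" for n
    using alpha_pos p by (intro cf_gap_strict_decreasing) (auto simp: alpha_Suc)
  show "?e n > 0" "?e n < cf_gap p m (alpha p q n)"
    using alternating_pos [of ?e, OF lim rec dec] by auto
qed

lemma rho_error_abs: "\<bar>rho p q m n - R p q n\<bar> = (-1) ^ m * (rho p q m n - R p q n)"
proof -
  have "\<bar>rho p q m n - R p q n\<bar> = \<bar>(-1) ^ m * (rho p q m n - R p q n)\<bar>"
    by (simp add: abs_mult)
  then show ?thesis using rho_error_bounds(1) [of m n] by linarith
qed

section \<open>Sharp asymptotics of the error\<close>

lemma rho_error_alpha_asymp:
  "(\<lambda>n. alpha p q n ^ (2 * m + 3) * \<bar>rho p q m n - R p q n\<bar>)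
     \<longlonglongrightarrow> (fact (m + 1) * real p ^ (m + 1))\<^sup>2"
proof -
  let ?a = "alpha p q"
  let ?C = "2 * (fact (Suc m + 1) * real p ^ (Suc m + 1))\<^sup>2"
  have main: "(\<lambda>n. ?a n ^ (2 * m + 3) * (rho p q m n - rho p q (Suc m) n))
    \<longlonglongrightarrow> (-1) ^ m * (fact (m + 1) * real p ^ (m + 1))\<^sup>2"
    unfolding rho_def by (rule filterlim_compose [OF cf_convergent_diff_asymp alpha_at_top])
  \<comment> \<open>The bound at level m + 1 has exponent 2m + 5, two more than the normalising
    power, and \<open>?C\<close> is its constant.\<close>
  have rest: "(\<lambda>n. ?a n ^ (2 * m + 3) * (rho p q (Suc m) n - R p q n)) \<longlonglongrightarrow> 0"
  proof (rule tendsto_rabs_zero_cancel, rule tendsto_sandwich [OF _ _ tendsto_const])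
    have "((\<lambda>a::real. ?C / a\<^sup>2) \<longlongrightarrow> 0) at_top" by real_asymp
    then show "(\<lambda>n. ?C / (?a n)\<^sup>2) \<longlonglongrightarrow> 0"
      by (rule filterlim_compose [OF _ alpha_at_top])
    show "\<forall>\<^sub>F n in sequentially.
      \<bar>?a n ^ (2 * m + 3) * (rho p q (Suc m) n - R p q n)\<bar> \<le> ?C / (?a n)\<^sup>2"
    proof (intro always_eventually allI)
      fix n
      have a: "?a n > 0" by (rule alpha_pos)
      have "\<bar>rho p q (Suc m) n - R p q n\<bar> \<le> ?C / ?a n ^ (2 * Suc m + 3)"
        using rho_error_bounds(2) [of "Suc m" n] cf_gap_le [OF a, of p "Suc m"]
        unfolding rho_error_abs by linarith
      then have "?a n ^ (2 * m + 3) * \<bar>rho p q (Suc m) n - R p q n\<bar>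
        \<le> ?a n ^ (2 * m + 3) * (?C / ?a n ^ (2 * Suc m + 3))"
        using a by (intro mult_left_mono) auto
      also have "2 * Suc m + 3 = (2 * m + 3) + 2" by simp
      also have "?a n ^ (2 * m + 3) * (?C / ?a n ^ ((2 * m + 3) + 2)) = ?C / (?a n)\<^sup>2"
        unfolding power_add [of _ "2 * m + 3" 2] using a by simp
      finally show "\<bar>?a n ^ (2 * m + 3) * (rho p q (Suc m) n - R p q n)\<bar> \<le> ?C / (?a n)\<^sup>2"
        using a by (simp add: abs_mult)
    qed
    show "\<forall>\<^sub>F n in sequentially. 0 \<le> \<bar>?a n ^ (2 * m + 3) * (rho p q (Suc m) n - R p q n)\<bar>"
      by simp
  qed
  have "(\<lambda>n. \<bar>?a n ^ (2 * m + 3) * (rho p q m n - R p q n)\<bar>)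
    \<longlonglongrightarrow> \<bar>(-1) ^ m * (fact (m + 1) * real p ^ (m + 1))\<^sup>2\<bar>"
    by (rule tendsto_rabs) (use tendsto_add [OF main rest] in \<open>simp add: algebra_simps\<close>)
  then show ?thesis
    using alpha_pos by (simp add: abs_mult less_imp_le)
qed

lemma n_over_alpha_tendsto: "(\<lambda>n. real n / alpha p q n) \<longlonglongrightarrow> 1 / (2 * real p)"
proof -
  have "(\<lambda>n. real n / alpha p q n) \<longlonglongrightarrow> inverse (real p) / 2"
    using p unfolding alpha_def by real_asymp
  then show ?thesis by (simp add: inverse_eq_divide mult.commute)
qed

text \<open>As n/alpha tends to 1/(2p), p^(2m+2) cancels against (2p)^(2m+3) and leaves a single p
  below.\<close>

lemma rho_error_asymp:
  "(\<lambda>n. real n ^ (2 * m + 3) * \<bar>rho p q m n - R p q n\<bar>)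
     \<longlonglongrightarrow> (fact (m + 1))\<^sup>2 / (2 ^ (2 * m + 3) * real p)"
proof -
  have "(\<lambda>n. (real n / alpha p q n) ^ (2 * m + 3)
      * (alpha p q n ^ (2 * m + 3) * \<bar>rho p q m n - R p q n\<bar>))
    \<longlonglongrightarrow> (1 / (2 * real p)) ^ (2 * m + 3) * (fact (m + 1) * real p ^ (m + 1))\<^sup>2"
    by (intro tendsto_intros n_over_alpha_tendsto rho_error_alpha_asymp)
  moreover have "(real n / alpha p q n) ^ (2 * m + 3)
      * (alpha p q n ^ (2 * m + 3) * \<bar>rho p q m n - R p q n\<bar>)
      = real n ^ (2 * m + 3) * \<bar>rho p q m n - R p q n\<bar>" for n
    using alpha_pos [of n] by (simp add: power_divide)
  moreover have "(1 / (2 * real p)) ^ (2 * m + 3) * (fact (m + 1) * real p ^ (m + 1))\<^sup>2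
    = (fact (m + 1))\<^sup>2 / (2 ^ (2 * m + 3) * real p)"
  proof -
    have "real p ^ (2 * m + 3) = (real p ^ (m + 1))\<^sup>2 * real p"
      unfolding power_double_add_3 by (simp add: power2_eq_square mult_ac)
    then show ?thesis
      using p by (simp add: power_divide power_mult_distrib del: power_Suc fact_Suc)
  qed
  ultimately show ?thesis by simp
qed

text \<open>The case m = 0 of the error asymptotics: \<open>rho p q 0 n\<close> is 1/alpha, so 1 -
  alpha R is alpha times an error of order alpha^(-3).\<close>

lemma R_alpha_asymp: "(\<lambda>n. alpha p q n * R p q n) \<longlonglongrightarrow> 1"
proof -
  let ?a = "alpha p q"
  have "((\<lambda>a::real. 1 / a\<^sup>2) \<longlongrightarrow> 0) at_top" by real_asymp
  then have "(\<lambda>n. 1 / (?a n)\<^sup>2) \<longlonglongrightarrow> 0"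
    by (rule filterlim_compose [OF _ alpha_at_top])
  from tendsto_diff [OF tendsto_const [of 1] tendsto_mult [OF this rho_error_alpha_asymp [of 0]]]
  have "(\<lambda>n. 1 - 1 / (?a n)\<^sup>2 * (?a n ^ (2 * 0 + 3) * \<bar>rho p q 0 n - R p q n\<bar>)) \<longlonglongrightarrow> 1"
    by simp
  moreover have "1 - 1 / (?a n)\<^sup>2 * (?a n ^ (2 * 0 + 3) * \<bar>rho p q 0 n - R p q n\<bar>) = ?a n * R p q n" for n
    unfolding rho_error_abs using alpha_pos [of n]
    by (simp add: rho_def field_simps power2_eq_square power3_eq_cube)
  ultimately show ?thesis by simp
qed

section \<open>Convergence speed of the corrected partial sums\<close>

lemma u_error: "u p q m n - S p q = (-1) ^ (n + 1) * (rho p q m n - R p q n)"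
  unfolding u_def S_eq_R [of p q n] by (simp add: algebra_simps)

lemma u_error_abs: "\<bar>u p q m n - S p q\<bar> = \<bar>rho p q m n - R p q n\<bar>"
  unfolding u_error by (simp add: abs_mult)

lemma S_part_error_abs: "\<bar>S_part p q n - S p q\<bar> = R p q n"
proof -
  have "\<bar>S_part p q n - S p q\<bar> = \<bar>R p q n\<bar>"
    unfolding R_def by (simp add: abs_mult abs_minus_commute)
  then show ?thesis using R_pos [of n] by simp
qed

lemma u_tendsto: "u p q m \<longlonglongrightarrow> S p q"
proof -
  have "(\<lambda>n. \<bar>rho p q m n - R p q n\<bar>) \<longlonglongrightarrow> 0"
    using tendsto_diff [OF rho_tendsto_0 R_tendsto_0] by (simp add: tendsto_rabs_zero_iff)
  then have "(\<lambda>n. u p q m n - S p q) \<longlonglongrightarrow> 0"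
    unfolding u_error_abs [symmetric] by (simp add: tendsto_rabs_zero_iff)
  then show ?thesis by (rule LIM_zero_cancel)
qed

text \<open>The errors scaled by n^(2m+3) have a nonzero limit, so their consecutive quotients tend
  to 1, and so does (n/(n+1))^(2m+3).\<close>

lemma u_infra_linear: "infra_linear (u p q m) (S p q)"
proof -
  let ?e = "\<lambda>n. \<bar>rho p q m n - R p q n\<bar>"
  let ?s = "2 * m + 3"
  let ?L = "(fact (m + 1))\<^sup>2 / (2 ^ (2 * m + 3) * real p)"
  have ne: "rho p q m n \<noteq> R p q n" for n
    using rho_error_bounds(1) [of m n] by auto
  have L: "?L \<noteq> 0" using p by simp
  have "(\<lambda>n. real n / real (Suc n)) \<longlonglongrightarrow> 1" by real_asymp
  then have "(\<lambda>n. (real n / real (Suc n)) ^ ?s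
      * ((real (Suc n) ^ ?s * ?e (Suc n)) / (real n ^ ?s * ?e n))) \<longlonglongrightarrow> 1 ^ ?s * (?L / ?L)"
    by (intro tendsto_mult tendsto_power tendsto_divide rho_error_asymp L
          LIMSEQ_Suc [of "\<lambda>n. real n ^ ?s * ?e n"])
  \<comment> \<open>At n = 0 the left side is 0 and the right side is not, so the equality is only
    eventual.\<close>
  moreover have "\<forall>\<^sub>F n in sequentially. (real n / real (Suc n)) ^ ?s
      * ((real (Suc n) ^ ?s * ?e (Suc n)) / (real n ^ ?s * ?e n)) = ?e (Suc n) / ?e n"
    using eventually_gt_at_top [of 0]
    by eventually_elim (simp add: power_divide ne del: of_nat_Suc)
  ultimately have "(\<lambda>n. ?e (Suc n) / ?e n) \<longlonglongrightarrow> 1"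
    using L by (auto elim!: Lim_transform_eventually)
  moreover have "u p q m n \<noteq> S p q" for n
    using u_error_abs [of m n] ne [of n] by auto
  ultimately show ?thesis
    unfolding infra_linear_def abs_divide u_error_abs using u_tendsto by simp
qed

text \<open>The error is of order alpha^(-2m-3) and the remainder R of order 1/alpha, so their
  quotient is of order alpha^(-2m-2).\<close>

lemma u_converges_faster: "converges_faster (u p q m) (S_part p q) (S p q)"
proof -
  let ?a = "alpha p q"
  let ?e = "\<lambda>n. \<bar>rho p q m n - R p q n\<bar>"
  have "((\<lambda>a::real. 1 / a) \<longlongrightarrow> 0) at_top" by real_asymp
  then have inv: "(\<lambda>n. 1 / ?a n) \<longlonglongrightarrow> 0"
    by (rule filterlim_compose [OF _ alpha_at_top])
  have "(\<lambda>n. (1 / ?a n) ^ (2 * m + 2) * ((?a n ^ (2 * m + 3) * ?e n) / (?a n * R p q n)))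
     \<longlonglongrightarrow> 0 ^ (2 * m + 2) * ((fact (m + 1) * real p ^ (m + 1))\<^sup>2 / 1)"
    by (intro tendsto_mult tendsto_power tendsto_divide rho_error_alpha_asymp R_alpha_asymp inv) simp
  moreover have "(1 / ?a n) ^ (2 * m + 2) * ((?a n ^ (2 * m + 3) * ?e n) / (?a n * R p q n))
      = ?e n / R p q n" for n
  proof -
    have "?a n ^ (2 * m + 3) = ?a n ^ (2 * m + 2) * ?a n"
      by (simp flip: power_Suc2 add: numeral_3_eq_3)
    then show ?thesis
      using alpha_pos [of n] by (simp add: power_divide)
  qed
  ultimately have "(\<lambda>n. ?e n / R p q n) \<longlonglongrightarrow> 0" by simp
  moreover have "S_part p q n \<noteq> S p q" for n
    using S_part_error_abs [of n] R_pos [of n] by auto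
  ultimately show ?thesis
    unfolding converges_faster_def abs_divide u_error_abs S_part_error_abs
    using u_tendsto S_part_tendsto by simp
qed

end

theorem mainTheorem2:
  fixes p q m :: nat
  assumes "p > 0" and "q > 0"
  shows "infra_linear (u p q m) (S p q)
    \<and> converges_faster (u p q m) (S_part p q) (S p q)
    \<and> (\<forall>n. \<bar>u p q m n - S p q\<bar> = \<bar>rho p q m n - R p q n\<bar>)
    \<and> (\<lambda>n. \<bar>rho p q m n - R p q n\<bar>) \<sim>[sequentially]
        (\<lambda>n. (fact (m + 1))\<^sup>2 / (2 ^ (2 * m + 3) * real p) * (1 / real n ^ (2 * m + 3)))"
proof (intro conjI allI u_infra_linear u_converges_faster u_error_abs assms)
  let ?L = "(fact (m + 1))\<^sup>2 / (2 ^ (2 * m + 3) * real p)"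
  have L: "?L \<noteq> 0" using assms by simp
  have "(\<lambda>n. real n ^ (2 * m + 3) * \<bar>rho p q m n - R p q n\<bar> / ?L) \<longlonglongrightarrow> ?L / ?L"
    by (intro tendsto_divide rho_error_asymp assms tendsto_const L)
  \<comment> \<open>At n = 0 both quotients are 0 by the convention for division by zero, so the
    rewriting holds for every n.\<close>
  then have "(\<lambda>n. \<bar>rho p q m n - R p q n\<bar> / (?L * (1 / real n ^ (2 * m + 3)))) \<longlonglongrightarrow> 1"
    using L by (simp add: mult_ac)
  then show "(\<lambda>n. \<bar>rho p q m n - R p q n\<bar>) \<sim>[sequentially]
        (\<lambda>n. ?L * (1 / real n ^ (2 * m + 3)))"
    by (rule asymp_equivI')
qed

end
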